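(* Let $Q^T\tau$ be a system of functions of interest, where $Q$ is a $v\times s$ matrix with $\mathcal{C}(Q)\subseteq\mathcal{E}$, such that $r=\mathrm{rank}(Q)$ satisfies $r=\dim(\mathcal{E})$. Then the weight matrices $W_1=QQ^T$ and $W_2=(I-P_\tau)+QQ^T$ are estimation equivalent; that is, $q^TW_1^-q=q^TW_2^{-1}q$ for any $q\in\mathcal{E}$.
   Context: $\mathcal{E}$ is a fixed linear subspace of $\mathbb{R}^v$ (the estimation space, i.e. the set of coefficient vectors $q$ of the estimable functions $q^T\tau$ of the parameter vector $\tau\in\mathbb{R}^v$), $P_\tau$ is the $v\times v$ matrix of the orthogonal projection on $\mathcal{E}$, $\mathcal{C}(A)$ denotes the column space of $A$, and $A^-$ denotes any generalized inverse of $A$ (any matrix with $AA^-A=A$); for $q\in\mathcal{C}(W_1)$ the value $q^TW_1^-q$ does not depend on the choice of $W_1^-$. Under the stated rank condition $W_2$ is positive definite. The weight assigned to $q^T\tau$ by a weight matrix $W$ is $(q^TW^-q)^{-1}$, and estimation equivalence of two weight matrices means that the quantities $q^TW_1^-q$ and $q^TW_2^-q$ agree up to a constant positive factor for all $q\in\mathcal{E}$; here the claim is that they agree with factor $1$. *)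

theory Defs
  imports "HOL-Analysis.Analysis"
begin

definition column_space :: "real ^ 'n ^ 'm \<Rightarrow> (real ^ 'm) set" where
  "column_space A = span (columns A)"

definition generalized_inverse :: "real ^ 'n ^ 'm \<Rightarrow> real ^ 'm ^ 'n \<Rightarrow> bool" where
  "generalized_inverse A G \<longleftrightarrow> A ** G ** A = A"

definition orthogonal_projection_matrix :: "(real ^ 'n) set \<Rightarrow> real ^ 'n ^ 'n \<Rightarrow> bool" where
  "orthogonal_projection_matrix S P \<longleftrightarrow>
     (\<forall>x. P *v x \<in> S \<and> (\<forall>y\<in>S. orthogonal (x - P *v x) y))"

(* The quadratic forms are compared for every choice of the generalized inverses; the
   factor c depends neither on q nor on these choices. *)
definition estimation_equivalent ::
  "(real ^ 'n) set \<Rightarrow> real ^ 'n ^ 'n \<Rightarrow> real ^ 'n ^ 'n \<Rightarrow> bool" where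
  "estimation_equivalent E W1 W2 \<longleftrightarrow>
     (\<exists>c>0. \<forall>q\<in>E. \<forall>G1 G2. generalized_inverse W1 G1 \<longrightarrow> generalized_inverse W2 G2 \<longrightarrow>
        q \<bullet> (G1 *v q) = c * (q \<bullet> (G2 *v q)))"

end

theory Submission
  imports Defs
begin

text \<open>For \<open>q \<in> E\<close> put \<open>z = W2\<^sup>-\<^sup>1 q\<close>. In \<open>(z - P z) + W1 z = q\<close> the first summand is orthogonal to \<open>E\<close>,
  while \<open>W1 z\<close> and \<open>q\<close> lie in \<open>E\<close>, hence \<open>W1 z = q\<close>. Symmetry of \<open>W1\<close> then gives
  \<open>q \<bullet> G q = z \<bullet> W1 G W1 z = z \<bullet> W1 z = q \<bullet> z\<close> for every generalized inverse \<open>G\<close> of \<open>W1\<close>.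
  The rank condition makes \<open>ker Q\<^sup>T\<close> the orthogonal complement of \<open>E\<close>, whence \<open>W2\<close> is invertible.\<close>

lemma column_space_eq_range: "column_space A = range (\<lambda>x. A *v x)"
  unfolding column_space_def
proof
  have "columns A \<subseteq> range (\<lambda>x. A *v x)"
    by (auto simp: columns_def simp flip: matrix_vector_mult_basis)
  moreover have "subspace (range (\<lambda>x. A *v x))"
    using matrix_vector_mul_linear linear_subspace_image subspace_UNIV by blast
  ultimately show "span (columns A) \<subseteq> range (\<lambda>x. A *v x)"
    by (rule span_minimal)
qed (auto intro: matrix_vector_mult_in_columnspace)

lemma column_space_eqI:
  assumes "subspace E" "column_space A \<subseteq> E" "rank A = dim E"
  shows "column_space A = E"
  using assms unfolding column_space_def column_rank_def
  by (intro subspace_dim_equal) auto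

lemma inner_transpose_matrix_vector:
  fixes A :: "real ^ 'n ^ 'm"
  shows "(transpose A *v x) \<bullet> y = x \<bullet> (A *v y)"
  by (simp add: dot_lmul_matrix)

text \<open>Pairing \<open>A ** transpose A *v x\<close> with \<open>x\<close> gives the squared
  norm of \<open>transpose A *v x\<close>, which must therefore vanish; moving \<open>A\<close>
  across the inner product then annihilates every \<open>A *v u\<close>.\<close>

lemma transpose_mult_eq_0_orthogonal_column_space:
  fixes A :: "real ^ 'n ^ 'm"
  assumes "(A ** transpose A) *v x = 0" "y \<in> column_space A"
  shows "x \<bullet> y = 0"
proof -
  have "(transpose A *v x) \<bullet> (transpose A *v x) = x \<bullet> ((A ** transpose A) *v x)"
    by (simp only: inner_transpose_matrix_vector matrix_vector_mul_assoc)
  then have "transpose A *v x = 0"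
    using assms(1) by simp
  moreover obtain u where "y = A *v u"
    using assms(2) by (auto simp: column_space_eq_range)
  ultimately show ?thesis
    by (metis inner_transpose_matrix_vector inner_zero_left)
qed

lemma matrix_inv_mult:
  assumes "invertible A"
  shows "A ** matrix_inv A = mat 1" "matrix_inv A ** A = mat 1"
  using someI_ex[OF assms[unfolded invertible_def]] by (auto simp: matrix_inv_def)

text \<open>Cancelling \<open>A\<close> on both sides of \<open>A ** G ** A = A\<close> leaves no
  freedom for \<open>G\<close>.\<close>

lemma generalized_inverse_invertible:
  assumes "invertible A" "generalized_inverse A G"
  shows "G = matrix_inv A"
proof -
  have "matrix_inv A ** (A ** G ** A) ** matrix_inv A = matrix_inv A ** A ** matrix_inv A"
    using assms(2) by (simp add: generalized_inverse_def)
  moreover have "matrix_inv A ** (A ** G ** A) ** matrix_inv A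
      = (matrix_inv A ** A) ** G ** (A ** matrix_inv A)"
    by (simp only: matrix_mul_assoc)
  ultimately show ?thesis
    by (simp add: matrix_inv_mult[OF assms(1)])
qed

lemma generalized_inverse_quadratic_form:
  fixes A :: "real ^ 'n ^ 'n"
  assumes "transpose A = A" "generalized_inverse A G"
  shows "(A *v z) \<bullet> (G *v (A *v z)) = (A *v z) \<bullet> z"
proof -
  have "(A *v z) \<bullet> y = z \<bullet> (A *v y)" for y
    using inner_transpose_matrix_vector[of A z y] assms(1) by simp
  then show ?thesis
    using assms(2) by (simp add: generalized_inverse_def matrix_vector_mul_assoc matrix_mul_assoc)
qed

text \<open>The residual equals \<open>b - a\<close>, so it lies in \<open>E\<close> as well as in
  its orthogonal complement and is orthogonal to itself.\<close>

lemma orthogonal_complement_part_eq_0: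
  assumes "subspace E" "orthogonal_projection_matrix E P"
    and "a \<in> E" "b \<in> E" "(x - P *v x) + a = b"
  shows "x - P *v x = 0"
proof -
  have "x - P *v x = b - a"
    using assms(5) by (simp add: algebra_simps)
  then have "x - P *v x \<in> E"
    using assms(1,3,4) by (simp add: subspace_diff)
  then show ?thesis
    using assms(2) by (metis orthogonal_projection_matrix_def orthogonal_self)
qed

theorem proposition3:
  fixes E :: "(real ^ 'v) set"
    and P :: "real ^ 'v ^ 'v"
    and Q :: "real ^ 's ^ 'v"
    and W1 W2 :: "real ^ 'v ^ 'v"
  assumes "subspace E"
    and "orthogonal_projection_matrix E P"
    and "column_space Q \<subseteq> E"
    and "rank Q = dim E"
    and "W1 = Q ** transpose Q"
    and "W2 = (mat 1 - P) + Q ** transpose Q"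
  shows "estimation_equivalent E W1 W2 \<and>
    invertible W2 \<and>
    (\<forall>q\<in>E. \<forall>G. generalized_inverse W1 G \<longrightarrow>
        q \<bullet> (G *v q) = q \<bullet> (matrix_inv W2 *v q))"
proof -
  have W1_in: "W1 *v x \<in> E" for x
    using assms(3,5) by (auto simp: column_space_eq_range simp flip: matrix_vector_mul_assoc)
  have W2_mult: "W2 *v x = (x - P *v x) + W1 *v x" for x
    using assms(5,6) by (simp add: matrix_vector_mult_add_rdistrib matrix_vector_mult_diff_rdistrib)
  \<comment> \<open>Needed twice: with \<open>b = 0\<close> for the kernel of \<open>W2\<close>, and
    with \<open>b = q\<close> for the quadratic form.\<close>
  have W1_mult: "W1 *v x = b" "x - P *v x = 0" if "W2 *v x = b" "b \<in> E" for x b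
  proof -
    show "x - P *v x = 0"
      using orthogonal_complement_part_eq_0[OF assms(1,2) W1_in that(2)] that(1) W2_mult by metis
    then show "W1 *v x = b"
      using that(1) W2_mult by simp
  qed
  have "x = 0" if "W2 *v x = 0" for x
  proof -
    have *: "W1 *v x = 0" "x = P *v x"
      using W1_mult[OF that] assms(1) by (auto simp: subspace_0)
    have "x \<in> E"
      using *(2) assms(2) by (metis orthogonal_projection_matrix_def)
    \<comment> \<open>The rank condition enters here: \<open>column_space Q\<close> is all of
      \<open>E\<close>, so \<open>x\<close>, being in \<open>E\<close> and orthogonal to that column
      space, is orthogonal to itself.\<close>
    then show "x = 0"
      using transpose_mult_eq_0_orthogonal_column_space[of Q x x] *(1) assms(5)
        column_space_eqI[OF assms(1,3,4)] by simp
  qed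
  then have inv: "invertible W2"
    by (simp add: invertible_left_inverse matrix_left_invertible_ker)
  have eq: "q \<bullet> (G *v q) = q \<bullet> (matrix_inv W2 *v q)"
    if "q \<in> E" "generalized_inverse W1 G" for q G
  proof -
    define z where "z = matrix_inv W2 *v q"
    have "W2 *v z = q"
      using inv by (simp add: z_def matrix_vector_mul_assoc matrix_inv_mult)
    then have "W1 *v z = q"
      using W1_mult(1) that(1) by blast
    moreover have "transpose W1 = W1"
      using assms(5) by (simp add: matrix_transpose_mul)
    ultimately show ?thesis
      using generalized_inverse_quadratic_form[OF _ that(2), of z] by (simp add: z_def)
  qed
  \<comment> \<open>The factor is 1, and any generalized inverse of the invertible \<open>W2\<close>
    is \<open>matrix_inv W2\<close>, so \<open>eq\<close> covers all choices.\<close>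
  have "estimation_equivalent E W1 W2"
    unfolding estimation_equivalent_def
    using eq generalized_inverse_invertible[OF inv] by (intro exI[of _ 1]) auto
  then show ?thesis
    using inv eq by blast
qed

end
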